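(* Let $\mathscr{E}$ be a quasi-potential multi-leader multi-follower game with associated functions $\phi_1,\dots,\phi_N$, $h$, $\pi$. If $(x,w)$ is a global minimizer of the optimization problem $$\mathrm{P}^{\rm quasi}:\qquad \min_{(x',w')}\ \pi(x')+h(x',w')\quad\text{subject to}\quad (x',w')\in\mathcal{F}^{\rm quasi},$$ then $(x,y)$, where $y=(y_1,\dots,y_N)$ with $y_i=w$ for all $i\in\mathcal{N}$, is a global Nash equilibrium of $\mathscr{E}$.
   Context: Multi-leader multi-follower game $\mathscr{E}$: $\mathcal{N}=\{1,\dots,N\}$ is the set of leaders. Leader $i$ has a convex compact strategy set $X_i\subseteq\mathbb{R}^{m_i}$; $X=\prod_{i=1}^N X_i$. For $x=(x_1,\dots,x_N)$, $x^{-i}$ denotes $(x_1,\dots,x_{i-1},x_{i+1},\dots,x_N)$ and $(\bar x_i,x^{-i})$ denotes $x$ with $i$-th component replaced by $\bar x_i$. $Y$ is the ambient Euclidean space of follower strategy profiles. For each $x\in X$, the set of follower equilibria is $\mathcal{S}(x)\subseteq Y$, the (possibly multivalued, possibly empty) solution set of the variational inequality $\mathrm{VI}(G(x,\cdot),K(x))$, i.e. $\mathcal{S}(x)=\{y\in K(x): G(x,y)^\top(z-y)\ge 0\ \ \forall z\in K(x)\}$, where $K$ is a continuous set-valued map with closed convex values in $Y$ and $G$ is a continuous map of all its variables. Leader $i$ has a continuous objective $\varphi_i$ on $X\times Y$, written $\varphi_i(x_i,y_i;x^{-i})$, and (optimistic formulation) solves $$\mathrm{L}_i(x^{-i}):\quad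 \min_{x_i,y_i}\ \varphi_i(x_i,y_i;x^{-i})\quad\text{s.t. } x_i\in X_i,\ y_i\in\mathcal{S}(x).$$ Its feasible region is $\Omega_i(x^{-i})=\{(x_i,y_i): x_i\in X_i,\ y_i\in\mathcal{S}(x_i,x^{-i})\}$. Let $\mathcal{F}=\{(x,y): x_i\in X_i,\ y_i\in\mathcal{S}(x)\ \forall i\in\mathcal{N}\}$, with $y=(y_1,\dots,y_N)$. Global Nash equilibrium of $\mathscr{E}$: a point $(x,y)\in\mathcal{F}$ such that for all $i\in\mathcal{N}$ and all $(u_i,v_i)\in\Omega_i(x^{-i})$, $\varphi_i(x_i,y_i;x^{-i})\le\varphi_i(u_i,v_i;x^{-i})$. Quasi-potential game: $\mathscr{E}$ is quasi-potential if (i) there exist real-valued functions $\phi_1(x),\dots,\phi_N(x)$ on $X$ and a real-valued function $h$ on $X\times Y$ (the same for all leaders) such that $\varphi_i(x_i,y_i;x^{-i})=\phi_i(x)+h(x,y_i)$ for each $i$; and (ii) there is a function $\pi$ on $X$ such that for all $i$, all $x\in X$ and all $x_i'\in X_i$, $\phi_i(x_i;x^{-i})-\phi_i(x_i';x^{-i})=\pi(x_i;x^{-i})-\pi(x_i';x^{-i})$. The function $\pi+h$ is called the quasi-potential function. $\mathcal{F}^{\rm quasi}=\{(x,w): x_i\in X_i\ \forall i\in\mathcal{N},\ w\in\mathcal{S}(x)\}$. *)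

theory Defs
  imports "HOL-Analysis.Analysis"
begin

text \<open>
  The space of dimension \<open>n\<close>, for a natural number \<open>n\<close>, is the library's
  \<^const>\<open>Euclidean_space\<close> \<open>n\<close>: real sequences that vanish from index \<open>n\<close> on.
  This lets the dimensions of the leaders' strategy spaces differ. The sequences do not form an
  instance of \<^class>\<open>real_vector\<close>, so convexity is written out pointwise.
\<close>

definition convex_vectors :: "(nat \<Rightarrow> real) set \<Rightarrow> bool" where
  "convex_vectors S \<longleftrightarrow>
     (\<forall>a\<in>S. \<forall>b\<in>S. \<forall>s\<ge>0. \<forall>t\<ge>0. s + t = 1 \<longrightarrow> (\<lambda>k. s * a k + t * b k) \<in> S)"

type_synonym strategy_profile = "nat \<Rightarrow> nat \<Rightarrow> real"

text \<open>
  The value \<open>obj E i x v\<close> stands for \<open>\<phi>\<^sub>i(x\<^sub>i, v; x\<^sup>-\<^sup>i)\<close>; the leader's own decision and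
  those of the rivals are both read off the full profile \<open>x\<close>. The follower space \<open>Y\<close> is the
  type \<open>'y\<close>.
\<close>

record 'y game =
  num_leaders :: nat
  dims :: "nat \<Rightarrow> nat"
  strats :: "nat \<Rightarrow> (nat \<Rightarrow> real) set"
  K :: "strategy_profile \<Rightarrow> 'y set"
  G :: "strategy_profile \<Rightarrow> 'y \<Rightarrow> 'y"
  obj :: "nat \<Rightarrow> strategy_profile \<Rightarrow> 'y \<Rightarrow> real"

definition leaders :: "('y, 'm) game_scheme \<Rightarrow> nat set" where
  "leaders E = {1..num_leaders E}"

definition profiles :: "('y, 'm) game_scheme \<Rightarrow> strategy_profile set" where
  "profiles E = (\<Pi>\<^sub>E i\<in>leaders E. strats E i)"

definition profile_topology :: "('y, 'm) game_scheme \<Rightarrow> strategy_profile topology" where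
  "profile_topology E =
     product_topology (\<lambda>i. subtopology (Euclidean_space (dims E i)) (strats E i)) (leaders E)"

text \<open>
  Continuity of a set-valued map on a topological space: upper and lower semicontinuity, in the
  form of openness of the strong and the weak preimages of open sets.
\<close>

definition upper_semicontinuous :: "'a topology \<Rightarrow> ('a \<Rightarrow> 'b::topological_space set) \<Rightarrow> bool" where
  "upper_semicontinuous T F \<longleftrightarrow> (\<forall>U. open U \<longrightarrow> openin T {x \<in> topspace T. F x \<subseteq> U})"

definition lower_semicontinuous :: "'a topology \<Rightarrow> ('a \<Rightarrow> 'b::topological_space set) \<Rightarrow> bool" where
  "lower_semicontinuous T F \<longleftrightarrow> (\<forall>U. open U \<longrightarrow> openin T {x \<in> topspace T. F x \<inter> U \<noteq> {}})"

definition continuous_set_valued :: "'a topology \<Rightarrow> ('a \<Rightarrow> 'b::topological_space set) \<Rightarrow> bool" where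
  "continuous_set_valued T F \<longleftrightarrow> upper_semicontinuous T F \<and> lower_semicontinuous T F"

definition multi_leader_multi_follower_game ::
    "('y::euclidean_space, 'm) game_scheme \<Rightarrow> bool" where
  "multi_leader_multi_follower_game E \<longleftrightarrow>
     (\<forall>i\<in>leaders E. convex_vectors (strats E i) \<and>
                    compactin (Euclidean_space (dims E i)) (strats E i)) \<and>
     (\<forall>x\<in>profiles E. closed (K E x) \<and> convex (K E x)) \<and>
     continuous_set_valued (profile_topology E) (K E) \<and>
     continuous_map (prod_topology (profile_topology E) euclidean) euclidean
       (\<lambda>(x, v). G E x v) \<and>
     (\<forall>i\<in>leaders E.
        continuous_map (prod_topology (profile_topology E) euclidean) euclideanreal
          (\<lambda>(x, v). obj E i x v))"

definition VI_solutions :: "('y::real_inner \<Rightarrow> 'y) \<Rightarrow> 'y set \<Rightarrow> 'y set" where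
  "VI_solutions F C = {y \<in> C. \<forall>z\<in>C. F y \<bullet> (z - y) \<ge> 0}"

definition follower_equilibria ::
    "('y::euclidean_space, 'm) game_scheme \<Rightarrow> strategy_profile \<Rightarrow> 'y set" where
  "follower_equilibria E x = VI_solutions (G E x) (K E x)"

text \<open>
  The region \<open>\<Omega>\<^sub>i(x\<^sup>-\<^sup>i)\<close>. It is given the full profile \<open>x\<close>, but does not depend on \<open>x i\<close>.
\<close>

definition feasible_region ::
    "('y::euclidean_space, 'm) game_scheme \<Rightarrow> nat \<Rightarrow> strategy_profile \<Rightarrow>
     ((nat \<Rightarrow> real) \<times> 'y) set" where
  "feasible_region E i x = {(u, v). u \<in> strats E i \<and> v \<in> follower_equilibria E (x(i := u))}"

definition feasible_profiles ::
    "('y::euclidean_space, 'm) game_scheme \<Rightarrow> (strategy_profile \<times> (nat \<Rightarrow> 'y)) set" where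
  "feasible_profiles E =
     {(x, y). x \<in> profiles E \<and> y \<in> (\<Pi>\<^sub>E i\<in>leaders E. follower_equilibria E x)}"

definition global_nash_equilibrium ::
    "('y::euclidean_space, 'm) game_scheme \<Rightarrow> strategy_profile \<Rightarrow> (nat \<Rightarrow> 'y) \<Rightarrow> bool" where
  "global_nash_equilibrium E x y \<longleftrightarrow>
     (x, y) \<in> feasible_profiles E \<and>
     (\<forall>i\<in>leaders E. \<forall>(u, v)\<in>feasible_region E i x. obj E i x (y i) \<le> obj E i (x(i := u)) v)"

definition quasi_potential ::
    "('y::euclidean_space, 'm) game_scheme \<Rightarrow> (nat \<Rightarrow> strategy_profile \<Rightarrow> real) \<Rightarrow>
     (strategy_profile \<Rightarrow> 'y \<Rightarrow> real) \<Rightarrow> (strategy_profile \<Rightarrow> real) \<Rightarrow> bool" where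
  "quasi_potential E \<phi> h \<pi> \<longleftrightarrow>
     (\<forall>i\<in>leaders E. \<forall>x\<in>profiles E. \<forall>v. obj E i x v = \<phi> i x + h x v) \<and>
     (\<forall>i\<in>leaders E. \<forall>x\<in>profiles E. \<forall>u\<in>strats E i.
        \<phi> i x - \<phi> i (x(i := u)) = \<pi> x - \<pi> (x(i := u)))"

definition quasi_feasible ::
    "('y::euclidean_space, 'm) game_scheme \<Rightarrow> (strategy_profile \<times> 'y) set" where
  "quasi_feasible E = {(x, w). x \<in> profiles E \<and> w \<in> follower_equilibria E x}"

end

theory Submission
  imports Defs
begin

text \<open>
  A deviation of leader \<open>i\<close> from \<open>(x, w)\<close> to \<open>(u, v)\<close> turns the profile \<open>x\<close> into
  \<open>x(i := u)\<close>, and by feasibility \<open>v\<close> is a follower equilibrium for that new profile. Hence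
  \<open>(x(i := u), v)\<close> is itself a feasible point of the optimization problem: there the follower
  variable is a single one, shared by all leaders, so the deviator's \<open>v\<close> can replace \<open>w\<close>
  without any condition coming from the other leaders' conjectures. By the quasi-potential
  property such a deviation changes the deviator's objective by exactly as much as it changes
  \<open>\<pi> + h\<close>, so minimality of \<open>(x, w)\<close> excludes any gain.
\<close>

lemma profiles_fun_upd:
  assumes "x \<in> profiles E" "i \<in> leaders E" "u \<in> strats E i"
  shows "x(i := u) \<in> profiles E"
  using assms PiE_fun_upd[of u "strats E" i x "leaders E"]
  by (simp add: profiles_def insert_absorb)

lemma quasi_feasible_deviation:
  assumes "x \<in> profiles E" "i \<in> leaders E" "(u, v) \<in> feasible_region E i x"
  shows "(x(i := u), v) \<in> quasi_feasible E"
  using assms by (auto simp: feasible_region_def quasi_feasible_def profiles_fun_upd)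

text \<open>
  The term \<open>h\<close> may change along with the profile and the follower variable, but it
  enters the objective and the quasi-potential function in the same way, so only the \<open>\<phi> i\<close>
  part has to be traded for \<open>\<pi>\<close>.
\<close>

lemma quasi_potential_deviation:
  assumes "quasi_potential E \<phi> h \<pi>" "x \<in> profiles E" "i \<in> leaders E" "u \<in> strats E i"
  shows "obj E i (x(i := u)) v - obj E i x w
       = (\<pi> (x(i := u)) + h (x(i := u)) v) - (\<pi> x + h x w)"
proof -
  have "\<phi> i x - \<phi> i (x(i := u)) = \<pi> x - \<pi> (x(i := u))"
    and "obj E i x w = \<phi> i x + h x w"
    and "obj E i (x(i := u)) v = \<phi> i (x(i := u)) + h (x(i := u)) v"
    using assms profiles_fun_upd[OF assms(2-4)] by (simp_all add: quasi_potential_def)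
  then show ?thesis by linarith
qed

theorem mainTheorem1:
  fixes E :: "'y::euclidean_space game"
    and \<phi> :: "nat \<Rightarrow> strategy_profile \<Rightarrow> real"
    and h :: "strategy_profile \<Rightarrow> 'y \<Rightarrow> real"
    and \<pi> :: "strategy_profile \<Rightarrow> real"
    and x :: strategy_profile
    and w :: 'y
  assumes "multi_leader_multi_follower_game E"
    and "quasi_potential E \<phi> h \<pi>"
    and "is_arg_min (\<lambda>(x', w'). \<pi> x' + h x' w') (\<lambda>p. p \<in> quasi_feasible E) (x, w)"
  shows "global_nash_equilibrium E x (\<lambda>i\<in>leaders E. w)"
proof -
  have x: "x \<in> profiles E" and w: "w \<in> follower_equilibria E x"
    using assms(3) by (auto simp: is_arg_min_def quasi_feasible_def)
  have minimal: "\<pi> x + h x w \<le> \<pi> x' + h x' w'" if "(x', w') \<in> quasi_feasible E" for x' w'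
    using assms(3) that by (fastforce simp: is_arg_min_linorder)
  have no_gain: "obj E i x w \<le> obj E i (x(i := u)) v"
    if i: "i \<in> leaders E" and uv: "(u, v) \<in> feasible_region E i x" for i u v
  proof -
    have "u \<in> strats E i"
      using uv by (simp add: feasible_region_def)
    with assms(2) x i have "obj E i (x(i := u)) v - obj E i x w
        = (\<pi> (x(i := u)) + h (x(i := u)) v) - (\<pi> x + h x w)"
      by (rule quasi_potential_deviation)
    with minimal[OF quasi_feasible_deviation[OF x i uv]] show ?thesis
      by linarith
  qed
  have "(x, \<lambda>i\<in>leaders E. w) \<in> feasible_profiles E"
    using x w by (simp add: feasible_profiles_def)
  with no_gain show ?thesis
    by (auto simp: global_nash_equilibrium_def)
qed

end
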